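(* For all positive integers $p,q$, the complete bipartite graph $K_{p,q}$ satisfies $\operatorname{diam}\mathcal{C}_3(K_{p,q})=\left\lfloor\frac{3(p+q)}{2}\right\rfloor$.
   Context: $K_{p,q}$ is the complete bipartite graph with parts of sizes $p$ and $q$. For a graph $G$, a $k$-colouring is a proper vertex colouring with colours from $[k]=\{1,\dots,k\}$ (not all colours need be used). The $k$-recolouring graph $\mathcal{C}_k(G)$ has as vertices the $k$-colourings of $G$; two $k$-colourings are adjacent precisely when they differ in the colour of exactly one vertex of $G$. $\operatorname{diam}\mathcal{C}_k(G)$ is the maximum over all pairs of $k$-colourings $\alpha,\beta$ of the distance from $\alpha$ to $\beta$ in $\mathcal{C}_k(G)$. *)

theory Defs
  imports "Graph_Theory.Graph_Theory"
begin

text \<open>Colourings are extensional (undefined outside the vertex set), so that two of them are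
  equal as functions iff they agree on all vertices.\<close>

definition colourings :: "nat \<Rightarrow> ('a, 'b) pre_digraph \<Rightarrow> ('a \<Rightarrow> nat) set" where
  "colourings k G =
     {c \<in> verts G \<rightarrow>\<^sub>E {1..k}. \<forall>u v. u \<rightarrow>\<^bsub>G\<^esub> v \<longrightarrow> c u \<noteq> c v}"

definition recolouring_graph :: "nat \<Rightarrow> ('a, 'b) pre_digraph \<Rightarrow> ('a \<Rightarrow> nat) pair_pre_digraph" where
  "recolouring_graph k G =
     \<lparr>pverts = colourings k G,
      parcs = {(\<alpha>, \<beta>). \<alpha> \<in> colourings k G \<and> \<beta> \<in> colourings k G \<and>
                (\<exists>!v. v \<in> verts G \<and> \<alpha> v \<noteq> \<beta> v)}\<rparr>"

text \<open>Every arc has cost 1, so \<open>\<mu>\<close> is the usual graph distance, with value \<open>\<infinity>\<close> for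
  vertices that are not connected. For a finite non-empty graph the supremum is a maximum.\<close>

definition (in wf_digraph) diam :: ereal where
  "diam = (SUP (u, v) \<in> verts G \<times> verts G. \<mu> (\<lambda>_. 1) u v)"

lemma wf_recolouring_graph: "wf_digraph (with_proj (recolouring_graph k G))"
  by unfold_locales (auto simp: recolouring_graph_def)

end

theory Submission
  imports Defs
begin

text \<open>A 3-colouring of \<open>K\<^bsub>p,q\<^esub>\<close> lifts to an integer height function which changes by
  exactly 1 along every edge and reduces to the colouring modulo 3. The lift is unique up to a
  global shift by a multiple of 6 once the parities on the two parts are fixed, and recolouring
  one vertex changes its height by \<open>\<plusminus>2\<close>. Hence the distance of two colourings is half the smallest
  \<open>L\<^sup>1\<close>-distance between lifts. With \<open>n = p + q\<close>, shifting a lift by 6 costs \<open>6 n\<close>: going round in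
  the one or the other direction bounds the distance by \<open>3 n / 2\<close>, and two lifts whose height sums
  differ by \<open>2 \<lfloor>3 n / 2\<rfloor>\<close> attain the bound.\<close>

lemma even_diff_less_imp_add_2_le: "even (a - b) \<Longrightarrow> a < b \<Longrightarrow> a + 2 \<le> (b :: int)"
  by presburger

lemma three_dvd_abs_le_2: "3 dvd a \<Longrightarrow> \<bar>a\<bar> \<le> 2 \<Longrightarrow> a = (0 :: int)"
  by presburger

text \<open>The sum is odd and at most 3 in absolute value, so only 3 and -3 have to be
  excluded.\<close>

lemma abs_sum_3_units_eq_1:
  fixes a b c :: int
  assumes "\<bar>a\<bar> = 1" "\<bar>b\<bar> = 1" "\<bar>c\<bar> = 1" "\<not> 3 dvd a + b + c"
  shows "\<bar>a + b + c\<bar> = 1"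
proof -
  have "a = 1 \<or> a = -1" "b = 1 \<or> b = -1" "c = 1 \<or> c = -1"
    using assms by linarith+
  then show ?thesis using assms(4) by auto
qed

section \<open>Height functions and the colourings they induce\<close>

context fin_digraph
begin

definition height :: "('a \<Rightarrow> int) \<Rightarrow> bool" where
  "height z \<longleftrightarrow> (\<forall>u v. u \<rightarrow> v \<longrightarrow> \<bar>z u - z v\<bar> = 1)"

definition colour_of :: "('a \<Rightarrow> int) \<Rightarrow> 'a \<Rightarrow> nat" where
  "colour_of z = (\<lambda>v\<in>verts G. nat (z v mod 3) + 1)"

interpretation R: wf_digraph "with_proj (recolouring_graph 3 G)"
  by (rule wf_recolouring_graph)

lemma heightD: "height z \<Longrightarrow> u \<rightarrow> v \<Longrightarrow> \<bar>z u - z v\<bar> = 1"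
  by (simp add: height_def)

lemma height_uminus: "height (\<lambda>v. - z v) \<longleftrightarrow> height z"
proof -
  have "\<bar>- z u - - z v\<bar> = \<bar>z u - z v\<bar>" for u v
    by linarith
  then show ?thesis by (simp only: height_def)
qed

lemma height_add_const: "height (\<lambda>v. z v + k) \<longleftrightarrow> height z"
  by (simp add: height_def)

lemma colour_of_apply: "v \<in> verts G \<Longrightarrow> int (colour_of z v) = z v mod 3 + 1"
  by (simp add: colour_of_def)

lemma colour_of_in_colourings:
  assumes "height z"
  shows "colour_of z \<in> colourings 3 G"
proof -
  have "nat (z v mod 3) < 3" for v
    by (simp add: nat_less_iff)
  then have "colour_of z \<in> verts G \<rightarrow>\<^sub>E {1..3}"
    by (auto simp: colour_of_def Suc_le_eq)
  moreover have "colour_of z u \<noteq> colour_of z v" if "u \<rightarrow> v" for u v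
  proof -
    have "z u mod 3 \<noteq> z v mod 3"
      using heightD[OF assms that] by presburger
    moreover have "u \<in> verts G" "v \<in> verts G"
      using that by auto
    ultimately show ?thesis
      using colour_of_apply[of u z] colour_of_apply[of v z] by force
  qed
  ultimately show ?thesis
    by (simp add: colourings_def)
qed

lemma colour_of_shift: "colour_of (\<lambda>v. z v + 6 * k) = colour_of z"
proof -
  have "(z v + 6 * k) mod 3 = z v mod 3" for v
    by presburger
  then show ?thesis by (simp add: colour_of_def)
qed

section \<open>Moving one height towards another\<close>

text \<open>Take \<open>v\<close> lowest under \<open>z\<close> among the vertices with
  \<open>z\<close> below \<open>w\<close>. Parity gives \<open>z v + 2 <= w v\<close>, so a
  neighbour at height \<open>z v - 1\<close> would itself be below \<open>w\<close>, and lower than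
  \<open>v\<close>. All neighbours thus sit at \<open>z v + 1\<close>, and raising \<open>v\<close>
  by 2 keeps the absolute differences equal to 1.\<close>

lemma height_raise:
  assumes z: "height z" and w: "height w"
    and ev: "\<And>v. v \<in> verts G \<Longrightarrow> even (z v - w v)"
    and ex: "\<exists>v\<in>verts G. z v < w v"
  obtains v where "v \<in> verts G" "z v < w v" "height (z(v := z v + 2))"
proof -
  let ?S = "{v \<in> verts G. z v < w v}"
  have "finite ?S" "?S \<noteq> {}"
    using ex by auto
  then obtain v where v: "v \<in> ?S" and min: "\<And>u. u \<in> ?S \<Longrightarrow> z v \<le> z u"
    by (metis (no_types, lifting) arg_min_if_finite(1) arg_min_least)
  have up: "z u = z v + 1" if uv: "u \<rightarrow> v \<or> v \<rightarrow> u" for u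
  proof (rule ccontr)
    assume ne: "z u \<noteq> z v + 1"
    have 1: "\<bar>z u - z v\<bar> = 1" "\<bar>w u - w v\<bar> = 1" "u \<in> verts G"
      using uv heightD[OF z] heightD[OF w] by fastforce+
    have "z v + 2 \<le> w v"
      using v ev[of v] even_diff_less_imp_add_2_le by blast
    then have "u \<in> ?S"
      using 1 ne by auto
    from min[OF this] show False
      using 1 ne by auto
  qed
  have "height (z(v := z v + 2))"
    unfolding height_def
  proof (intro allI impI)
    fix a b assume "a \<rightarrow> b"
    then show "\<bar>(z(v := z v + 2)) a - (z(v := z v + 2)) b\<bar> = 1"
      using up[of a] up[of b] heightD[OF z] by auto
  qed
  with v show ?thesis
    by (intro that) auto
qed

lemma height_lower:
  assumes z: "height z" and w: "height w"
    and ev: "\<And>v. v \<in> verts G \<Longrightarrow> even (z v - w v)"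
    and ex: "\<exists>v\<in>verts G. w v < z v"
  obtains v where "v \<in> verts G" "w v < z v" "height (z(v := z v - 2))"
proof -
  have *: "(\<lambda>u. - z u)(v := - z v + 2) = (\<lambda>u. - (z(v := z v - 2)) u)" for v
    by auto
  have "even (- z v - - w v)" if "v \<in> verts G" for v
    using ev[OF that] by presburger
  then obtain v where "v \<in> verts G" "- z v < - w v" "height (\<lambda>u. - (z(v := z v - 2)) u)"
    using height_raise[of "\<lambda>v. - z v" "\<lambda>v. - w v"] z w ex
    unfolding height_uminus * by (metis neg_less_iff_less)
  then show ?thesis
    unfolding height_uminus using that[of v] by linarith
qed

lemma recolouring_arc_fun_upd:
  assumes "height z" "height (z(v := x))" "v \<in> verts G" "\<bar>x - z v\<bar> = 2"
  shows "(colour_of z, colour_of (z(v := x))) \<in> parcs (recolouring_graph 3 G)"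
proof -
  have "x mod 3 \<noteq> z v mod 3"
    using assms(4) by presburger
  then have "colour_of z v \<noteq> colour_of (z(v := x)) v"
    using colour_of_apply[OF assms(3), of z] colour_of_apply[OF assms(3), of "z(v := x)"] by force
  moreover have "colour_of z u = colour_of (z(v := x)) u" if "u \<noteq> v" for u
    using that by (simp add: colour_of_def)
  ultimately have "\<exists>!u. u \<in> verts G \<and> colour_of z u \<noteq> colour_of (z(v := x)) u"
    using assms(3) by metis
  then show ?thesis
    using assms(1,2) by (simp add: recolouring_graph_def colour_of_in_colourings)
qed

lemma sum_abs_diff_fun_upd:
  fixes z w :: "'a \<Rightarrow> int"
  assumes "v \<in> verts G"
  shows "(\<Sum>u\<in>verts G. \<bar>(z(v := x)) u - w u\<bar>)
    = (\<Sum>u\<in>verts G. \<bar>z u - w u\<bar>) - \<bar>z v - w v\<bar> + \<bar>x - w v\<bar>"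
  using assms by (simp add: sum.remove[of _ v])

text \<open>By parity a vertex off target is off by at least 2, so a move by 2 towards the target
  never overshoots and lowers the \<open>L^1\<close>-distance by exactly 2. Induction on that
  distance builds the walk.\<close>

lemma height_walk_exists:
  assumes "height z" "height w" "\<And>v. v \<in> verts G \<Longrightarrow> even (z v - w v)"
  shows "\<exists>p. R.awalk (colour_of z) p (colour_of w)
    \<and> 2 * int (length p) = (\<Sum>v\<in>verts G. \<bar>z v - w v\<bar>)"
  using assms
proof (induction "nat (\<Sum>v\<in>verts G. \<bar>z v - w v\<bar>)" arbitrary: z rule: less_induct)
  case less
  show ?case
  proof (cases "\<forall>v\<in>verts G. z v = w v")
    case True
    then have "colour_of z = colour_of w"
      by (auto simp: colour_of_def)
    then show ?thesis
      using True colour_of_in_colourings[OF less.prems(1)]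
      by (intro exI[of _ "[]"]) (simp add: R.awalk_Nil_iff, simp add: recolouring_graph_def)
  next
    case False
    then consider "\<exists>v\<in>verts G. z v < w v" | "\<exists>v\<in>verts G. w v < z v"
      by (meson linorder_neqE)
    then obtain v x where v: "v \<in> verts G" "height (z(v := x))"
      and x: "\<bar>x - z v\<bar> = 2" "even (x - w v)" "\<bar>x - w v\<bar> = \<bar>z v - w v\<bar> - 2"
    proof cases
      case 1
      then obtain v where v: "v \<in> verts G" "z v < w v" "height (z(v := z v + 2))"
        using height_raise less.prems by blast
      moreover have "\<bar>z v + 2 - w v\<bar> = \<bar>z v - w v\<bar> - 2"
        using v less.prems(3)[of v] by presburger
      ultimately show ?thesis
        using that[of v "z v + 2"] less.prems(3)[of v] by simp
    next
      case 2
      then obtain v where v: "v \<in> verts G" "w v < z v" "height (z(v := z v - 2))"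
        using height_lower less.prems by blast
      moreover have "\<bar>z v - 2 - w v\<bar> = \<bar>z v - w v\<bar> - 2"
        using v less.prems(3)[of v] by presburger
      ultimately show ?thesis
        using that[of v "z v - 2"] less.prems(3)[of v] by simp
    qed
    let ?z = "z(v := x)"
    have s: "(\<Sum>u\<in>verts G. \<bar>?z u - w u\<bar>) = (\<Sum>u\<in>verts G. \<bar>z u - w u\<bar>) - 2"
      unfolding sum_abs_diff_fun_upd[OF v(1)] using x by simp
    moreover have "(\<Sum>u\<in>verts G. \<bar>?z u - w u\<bar>) \<ge> 0"
      by (rule sum_nonneg) simp
    ultimately have "nat (\<Sum>u\<in>verts G. \<bar>?z u - w u\<bar>) < nat (\<Sum>u\<in>verts G. \<bar>z u - w u\<bar>)"
      by linarith
    moreover have "even (?z u - w u)" if "u \<in> verts G" for u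
      using less.prems(3)[OF that] x by simp
    ultimately obtain p where p: "R.awalk (colour_of ?z) p (colour_of w)"
      "2 * int (length p) = (\<Sum>v\<in>verts G. \<bar>?z v - w v\<bar>)"
      using less.hyps[of ?z] v less.prems(2) by blast
    have "R.awalk (colour_of z) ((colour_of z, colour_of ?z) # p) (colour_of w)"
      using p(1) recolouring_arc_fun_upd[OF less.prems(1) v(2) v(1) x(1)]
      by (simp add: R.awalk_Cons_iff)
    moreover have "2 * int (length ((colour_of z, colour_of ?z) # p)) = (\<Sum>u\<in>verts G. \<bar>z u - w u\<bar>)"
      using p(2) unfolding s by simp
    ultimately show ?thesis by blast
  qed
qed

text \<open>Raising one vertex at a time without passing \<open>w\<close> makes the height sum run
  through all even offsets. This supplies an extremal colouring for the lower bound.\<close>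

lemma height_intermediate:
  assumes z: "height z" and w: "height w"
    and ev: "\<And>v. v \<in> verts G \<Longrightarrow> even (z v - w v)"
    and le: "\<And>v. v \<in> verts G \<Longrightarrow> z v \<le> w v"
    and "2 * int m \<le> (\<Sum>v\<in>verts G. w v - z v)"
  shows "\<exists>y. height y \<and> (\<forall>v\<in>verts G. even (z v - y v) \<and> y v \<le> w v)
    \<and> (\<Sum>v\<in>verts G. y v - z v) = 2 * int m"
  using assms(5)
proof (induction m)
  case 0
  then show ?case using z le by (intro exI[of _ z]) auto
next
  case (Suc m)
  then obtain y where y: "height y" "\<And>v. v \<in> verts G \<Longrightarrow> even (z v - y v)"
    "\<And>v. v \<in> verts G \<Longrightarrow> y v \<le> w v" "(\<Sum>v\<in>verts G. y v - z v) = 2 * int m"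
    by auto
  have ev': "even (y v - w v)" if "v \<in> verts G" for v
    using y(2)[OF that] ev[OF that] by presburger
  \<comment> \<open>Otherwise \<open>y\<close> agrees with \<open>w\<close> and has used up the
    whole sum, while \<open>Suc.prems\<close> leaves room for 2 more.\<close>
  have "\<exists>v\<in>verts G. y v < w v"
  proof (rule ccontr)
    assume "\<not> ?thesis"
    then have "\<forall>v\<in>verts G. y v = w v"
      using y(3) by fastforce
    then have "(\<Sum>v\<in>verts G. y v - z v) = (\<Sum>v\<in>verts G. w v - z v)"
      by simp
    then show False
      using y(4) Suc.prems by simp
  qed
  then obtain v where v: "v \<in> verts G" "y v < w v" "height (y(v := y v + 2))"
    using height_raise[OF y(1) w ev'] by metis
  have "even (z u - (y(v := y v + 2)) u)" "(y(v := y v + 2)) u \<le> w u" if "u \<in> verts G" for u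
    using y(2,3)[OF that] even_diff_less_imp_add_2_le[OF ev' v(2)] v(1) by auto
  moreover have "(\<Sum>u\<in>verts G. (y(v := y v + 2)) u - z u) = 2 * int (Suc m)"
    using y(4) v(1) by (simp add: sum.remove[of _ v])
  ultimately show ?case
    using v(3) by blast
qed

section \<open>Lifting recolouring walks to heights\<close>

text \<open>The two other colours at \<open>v\<close> are the residues of \<open>z v + 2\<close> and
  \<open>z v - 2\<close>, which dictates the new height. A neighbour then differs from it by 1 or 3,
  and 3 would mean equal colours, against the properness of \<open>d\<close>.\<close>

lemma height_lift_arc:
  assumes z: "height z" and arc: "(colour_of z, d) \<in> parcs (recolouring_graph 3 G)"
  shows "\<exists>v\<in>verts G. \<exists>x. \<bar>x - z v\<bar> = 2 \<and> height (z(v := x)) \<and> colour_of (z(v := x)) = d"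
proof -
  have d: "d \<in> verts G \<rightarrow>\<^sub>E {1..3}" "\<And>a b. a \<rightarrow> b \<Longrightarrow> d a \<noteq> d b"
    and ex1: "\<exists>!v. v \<in> verts G \<and> colour_of z v \<noteq> d v"
    using arc by (auto simp: recolouring_graph_def colourings_def)
  then obtain v where v: "v \<in> verts G" "colour_of z v \<noteq> d v"
    and rest: "\<And>u. u \<in> verts G \<Longrightarrow> u \<noteq> v \<Longrightarrow> colour_of z u = d u"
    by metis
  have dv: "d v \<in> {1..3}"
    using d(1) v(1) by auto
  moreover have "int (d v) \<noteq> z v mod 3 + 1"
    using v colour_of_apply[OF v(1), of z] by linarith
  ultimately have "int (d v) = (z v + 2) mod 3 + 1 \<or> int (d v) = (z v - 2) mod 3 + 1"
    by auto presburger
  then obtain x where x: "x = z v + 2 \<or> x = z v - 2" "int (d v) = x mod 3 + 1"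
    by blast
  let ?w = "z(v := x)"
  have "colour_of ?w u = d u" for u
  proof (cases "u \<in> verts G")
    case True
    then show ?thesis
    proof (cases "u = v")
      case True
      then show ?thesis using x(2) v(1) by (simp add: colour_of_def nat_add_distrib)
    next
      case False
      then show ?thesis using rest[OF True False] True by (simp add: colour_of_def)
    qed
  next
    case False
    then show ?thesis using d(1) by (auto simp: colour_of_def PiE_def extensional_def)
  qed
  then have col: "colour_of ?w = d" by blast
  have "height ?w"
    unfolding height_def
  proof (intro allI impI)
    fix a b assume ab: "a \<rightarrow> b"
    then have verts: "a \<in> verts G" "b \<in> verts G" by auto
    have 1: "\<bar>z a - z b\<bar> = 1" using heightD[OF z ab] .
    have "d a \<noteq> d b" using d(2)[OF ab] .
    then have "?w a mod 3 \<noteq> ?w b mod 3"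
      using colour_of_apply[OF verts(1), of ?w] colour_of_apply[OF verts(2), of ?w]
      unfolding col by force
    then show "\<bar>?w a - ?w b\<bar> = 1"
      using 1 x(1) by (cases "a = v"; cases "b = v"; simp) presburger+
  qed
  then show ?thesis
    using v(1) x(1) col by (intro bexI[of _ v] exI[of _ x]) auto
qed

text \<open>Each arc changes the height sum by 2 up or down, so the total drift of the sum bounds
  the length of the walk from below.\<close>

lemma height_lift_walk:
  assumes "height z" "R.awalk (colour_of z) p d"
  shows "\<exists>w. height w \<and> colour_of w = d \<and> (\<forall>v\<in>verts G. even (z v - w v))
    \<and> \<bar>\<Sum>v\<in>verts G. w v - z v\<bar> \<le> 2 * int (length p)"
  using assms
proof (induction p arbitrary: z)
  case Nil
  then show ?case by (intro exI[of _ z]) (auto simp: R.awalk_Nil_iff)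
next
  case (Cons e p)
  then have e: "(colour_of z, snd e) \<in> parcs (recolouring_graph 3 G)"
    and p: "R.awalk (snd e) p d"
    by (auto simp: R.awalk_Cons_iff)
  obtain v x where v: "v \<in> verts G" "\<bar>x - z v\<bar> = 2" "height (z(v := x))"
    and col: "colour_of (z(v := x)) = snd e"
    using height_lift_arc[OF Cons.prems(1) e] by blast
  obtain w where w: "height w" "colour_of w = d"
    "\<And>u. u \<in> verts G \<Longrightarrow> even ((z(v := x)) u - w u)"
    "\<bar>\<Sum>u\<in>verts G. w u - (z(v := x)) u\<bar> \<le> 2 * int (length p)"
    using Cons.IH[OF v(3)] p unfolding col by blast
  have "even (z u - w u)" if "u \<in> verts G" for u
    using w(3)[OF that] v(2) by (cases "u = v"; simp) presburger
  moreover have "(\<Sum>u\<in>verts G. w u - (z(v := x)) u) = (\<Sum>u\<in>verts G. w u - z u) + z v - x"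
    using v(1) by (simp add: sum.remove[of _ v])
  ultimately show ?case
    using w(1,2,4) v(2) by (intro exI[of _ w]) auto
qed

lemma recolouring_dist_le_walk: "R.awalk c p d \<Longrightarrow> R.\<mu> (\<lambda>_. 1) c d \<le> ereal (real (length p))"
  using R.min_cost_le_walk_cost[of c p d "\<lambda>_. 1"]
  by (simp add: R.awalk_cost_def sum_list_triv)

lemma recolouring_dist_geI:
  assumes "\<And>p. R.awalk c p d \<Longrightarrow> m \<le> length p"
  shows "ereal (real m) \<le> R.\<mu> (\<lambda>_. 1) c d"
  unfolding R.\<mu>_def
  using assms by (intro INF_greatest) (auto simp: R.awalk_cost_def sum_list_triv)

end

section \<open>Lifts of colourings of complete bipartite graphs\<close>

locale bipartition = fin_digraph +
  fixes U V :: "'a set"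
  assumes verts_eq: "verts G = U \<union> V"
    and disjoint: "U \<inter> V = {}"
    and arcs_eq: "arcs_ends G = U \<times> V \<union> V \<times> U"
    and nonempty: "U \<noteq> {}" "V \<noteq> {}"
begin

interpretation R: wf_digraph "with_proj (recolouring_graph 3 G)"
  by (rule wf_recolouring_graph)

lemma height_iff: "height z \<longleftrightarrow> (\<forall>u\<in>U. \<forall>v\<in>V. \<bar>z u - z v\<bar> = 1)"
proof -
  have "\<bar>z v - z u\<bar> = \<bar>z u - z v\<bar>" for u v
    by (rule abs_minus_commute)
  then show ?thesis
    unfolding height_def arcs_eq by (metis Un_iff mem_Sigma_iff)
qed

text \<open>A shift by 3 keeps the colours but swaps the parities. With fixed parities any two lifts
  differ by even amounts, which moves by 2 can bridge.\<close>

definition parity_height :: "('a \<Rightarrow> int) \<Rightarrow> bool" where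
  "parity_height z \<longleftrightarrow> height z \<and> (\<forall>u\<in>U. even (z u)) \<and> (\<forall>v\<in>V. odd (z v))"

lemma parity_height_even_diff:
  "parity_height z \<Longrightarrow> parity_height w \<Longrightarrow> v \<in> verts G \<Longrightarrow> even (z v - w v)"
  by (auto simp: parity_height_def verts_eq)

text \<open>Anchor the lift on an edge from \<open>a\<close> to \<open>b\<close>: place
  \<open>V\<close> around the height of \<open>a\<close> and \<open>U\<close> around that of
  \<open>b\<close>. For any \<open>u\<close> and \<open>v\<close>, the path \<open>u\<close>,
  \<open>b\<close>, \<open>a\<close>, \<open>v\<close> makes three unit steps whose total is not
  divisible by 3, hence is 1 or -1.\<close>

lemma colouring_lift:
  assumes c: "c \<in> colourings 3 G"
  shows "\<exists>z. parity_height z \<and> colour_of z = c"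
proof -
  have range: "c v \<in> {1..3}" if "v \<in> verts G" for v
    using c that by (auto simp: colourings_def)
  have proper: "c u \<noteq> c v" if "u \<in> U" "v \<in> V" for u v
    using c that by (auto simp: colourings_def arcs_eq)
  obtain a b where ab: "a \<in> U" "b \<in> V"
    using nonempty by auto
  \<comment> \<open>\<open>r x k\<close> is the integer congruent to \<open>k\<close> modulo 3 that is nearest to \<open>x\<close>.\<close>
  define r :: "int \<Rightarrow> int \<Rightarrow> int" where "r x k = x + ((k - x + 1) mod 3) - 1" for x k
  \<comment> \<open>The factor 4 is even and congruent to 1 modulo 3, so \<open>za\<close> is even
    and still has the residue of the colour of \<open>a\<close>.\<close>
  define za where "za = 4 * (int (c a) - 1)"
  define zb where "zb = r za (int (c b) - 1)"
  define z where "z v = (if v \<in> U then r zb (int (c v) - 1) else r za (int (c v) - 1))" for v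
  have r_mod: "r x k mod 3 = k mod 3" for x k
    unfolding r_def by presburger
  have r_near: "\<bar>r x k - x\<bar> = 1" if "x mod 3 \<noteq> k mod 3" for x k
    using that unfolding r_def by presburger
  have mod_eq: "z v mod 3 = int (c v) - 1" if "v \<in> verts G" for v
    using range[OF that] by (auto simp: z_def r_mod)
  have mod_ne: "(int (c u) - 1) mod 3 \<noteq> (int (c v) - 1) mod 3" if "u \<in> U" "v \<in> V" for u v
    using range[of u] range[of v] proper[OF that] that verts_eq by auto
  have za: "za mod 3 = (int (c a) - 1) mod 3"
    unfolding za_def by presburger
  have V: "\<bar>z v - za\<bar> = 1" if "v \<in> V" for v
    using r_near[of za "int (c v) - 1"] za mod_ne[OF ab(1) that] that disjoint
    by (auto simp: z_def)
  have zb: "\<bar>zb - za\<bar> = 1"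
    unfolding zb_def using za mod_ne[OF ab] by (intro r_near) simp
  have U: "\<bar>z u - zb\<bar> = 1" if "u \<in> U" for u
    using r_near[of zb "int (c u) - 1"] mod_ne[OF that ab(2)] that
    by (auto simp: z_def zb_def r_mod)
  have "even za" by (simp add: za_def)
  have "\<bar>z u - z v\<bar> = 1" if uv: "u \<in> U" "v \<in> V" for u v
  proof -
    have "z u mod 3 \<noteq> z v mod 3"
      using mod_ne[OF uv] uv disjoint by (auto simp: z_def r_mod)
    then have "\<not> 3 dvd (z u - zb) + (zb - za) + (za - z v)"
      by (simp add: mod_eq_dvd_iff)
    then have "\<bar>(z u - zb) + (zb - za) + (za - z v)\<bar> = 1"
      using U[OF uv(1)] V[OF uv(2)] zb
      by (intro abs_sum_3_units_eq_1) (auto simp: abs_minus_commute)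
    then show ?thesis by simp
  qed
  moreover have "odd (z v)" if "v \<in> V" for v
    using V[OF that] \<open>even za\<close> by presburger
  moreover have "even (z u)" if "u \<in> U" for u
    using U[OF that] zb \<open>even za\<close> by presburger
  ultimately have "parity_height z"
    by (simp add: parity_height_def height_iff)
  moreover have "colour_of z v = c v" for v
  proof (cases "v \<in> verts G")
    case True
    then show ?thesis using colour_of_apply[OF True, of z] mod_eq[OF True] by simp
  next
    case False
    then show ?thesis
      using c by (auto simp: colour_of_def colourings_def PiE_def extensional_def)
  qed
  ultimately show ?thesis by blast
qed

text \<open>Equal colours make \<open>w - z\<close> a multiple of 3, and along an edge it changes by
  at most 2, so it is the same at both ends and hence constant. Being also even, the constant is a
  multiple of 6.\<close>

lemma lift_unique:
  assumes z: "height z" and w: "height w"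
    and ev: "\<And>v. v \<in> verts G \<Longrightarrow> even (z v - w v)"
    and col: "colour_of z = colour_of w"
  shows "\<exists>k. \<forall>v\<in>verts G. w v = z v + 6 * k"
proof -
  obtain a b where ab: "a \<in> U" "b \<in> V"
    using nonempty by auto
  have mod_eq: "z v mod 3 = w v mod 3" if "v \<in> verts G" for v
    using colour_of_apply[OF that, of z] colour_of_apply[OF that, of w] col by simp
  have eq: "w u - z u = w v - z v" if "u \<in> U" "v \<in> V" for u v
  proof -
    have "\<bar>z u - z v\<bar> = 1" "\<bar>w u - w v\<bar> = 1" "z u mod 3 = w u mod 3" "z v mod 3 = w v mod 3"
      using z w that mod_eq verts_eq by (auto simp: height_iff)
    then have "3 dvd (w u - z u) - (w v - z v)" "\<bar>(w u - z u) - (w v - z v)\<bar> \<le> 2"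
      by (auto simp: mod_eq_dvd_iff dvd_diff_commute intro!: dvd_diff)
    then show ?thesis
      using three_dvd_abs_le_2 by fastforce
  qed
  have "a \<in> verts G" using ab verts_eq by auto
  then have "\<exists>k. w a - z a = 6 * k"
    using ev[of a] mod_eq[of a] by presburger
  then obtain k where k: "w a - z a = 6 * k" by blast
  have "w v - z v = 6 * k" if "v \<in> verts G" for v
    using that k eq[OF ab] eq[OF ab(1), of v] eq[OF _ ab(2), of v] verts_eq by auto
  then show ?thesis by (intro exI[of _ k]) (auto simp: algebra_simps)
qed

section \<open>Upper bound on the distance\<close>

text \<open>If all differences lie between two consecutive multiples of 6, the costs of these two
  shifts add up to 6 per vertex, so one of them costs at most half of that. Otherwise some
  difference exceeds the upper multiple, and shifting by that one costs at most 2 per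
  vertex.\<close>

lemma near_lift:
  assumes z: "parity_height z" and w: "parity_height w"
  shows "\<exists>k. (\<Sum>v\<in>verts G. \<bar>z v - (w v + 6 * k)\<bar>) \<le> 3 * int (card (verts G))"
proof -
  define d where "d v = z v - w v" for v
  have d_adj: "\<bar>d u - d v\<bar> \<le> 2" if "u \<in> U" "v \<in> V" for u v
    using z w that by (fastforce simp: parity_height_def height_iff d_def)
  have d_even: "even (d v)" if "v \<in> verts G" for v
    unfolding d_def by (rule parity_height_even_diff[OF z w that])
  have fin: "finite (d ` verts G)" "d ` verts G \<noteq> {}"
    using verts_eq nonempty finite_imageI[OF finite_verts] by auto
  \<comment> \<open>The minimum then lies in the window from \<open>6 * k\<close> to
    \<open>6 * k + 5\<close>.\<close>
  define k where "k = Min (d ` verts G) div 6"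
  obtain m where m: "m \<in> verts G" "Min (d ` verts G) = d m"
    using Min_in[OF fin] by auto
  have d_ge: "6 * k \<le> d v" if "v \<in> verts G" for v
    using Min_le[OF fin(1) imageI[OF that]] unfolding k_def m(2) by presburger
  have sum: "(\<Sum>v\<in>verts G. \<bar>z v - (w v + 6 * j)\<bar>) = (\<Sum>v\<in>verts G. \<bar>d v - 6 * j\<bar>)" for j
    by (simp add: d_def algebra_simps)
  show ?thesis
  proof (cases "\<forall>v\<in>verts G. d v \<le> 6 * k + 6")
    case True
    have "\<bar>d v - 6 * k\<bar> + \<bar>d v - 6 * (k + 1)\<bar> = 6" if "v \<in> verts G" for v
      using True d_ge that by fastforce
    then have "(\<Sum>v\<in>verts G. \<bar>d v - 6 * k\<bar>) + (\<Sum>v\<in>verts G. \<bar>d v - 6 * (k + 1)\<bar>)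
        = 6 * int (card (verts G))"
      unfolding sum.distrib[symmetric] by simp
    then have "(\<Sum>v\<in>verts G. \<bar>d v - 6 * k\<bar>) \<le> 3 * int (card (verts G))
        \<or> (\<Sum>v\<in>verts G. \<bar>d v - 6 * (k + 1)\<bar>) \<le> 3 * int (card (verts G))"
      by linarith
    then show ?thesis
      unfolding sum by blast
  next
    case False
    then obtain M where M: "M \<in> verts G" "d M > 6 * (k + 1)" by auto
    have M': "d M \<ge> 6 * (k + 1) + 2"
      using M d_even[of M] by presburger
    have "d m < 6 * (k + 1)"
      unfolding k_def m(2) by presburger
    then have m': "d m \<le> 6 * (k + 1) - 2"
      using d_even[OF m(1)] by presburger
    \<comment> \<open>The differences at \<open>m\<close> and \<open>M\<close> are at least 4 apart, so \<open>m\<close> and \<open>M\<close> lie in the same part, and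
      the other part is pinned to the value in the middle.\<close>
    have "\<bar>d v - 6 * (k + 1)\<bar> \<le> 2" if "v \<in> verts G" for v
    proof (cases "m \<in> U")
      case True
      have MU: "M \<in> U"
        using d_adj[OF True, of M] M(1) M' m' verts_eq by auto
      have "d b = 6 * (k + 1)" if "b \<in> V" for b
        using d_adj[OF True that] d_adj[OF MU that] M' m' by auto
      \<comment> \<open>A vertex of \<open>V\<close> has the pinned value, and a vertex of
        \<open>U\<close> is adjacent to one that has it.\<close>
      then show ?thesis
        using that verts_eq nonempty(2) d_adj by fastforce
    next
      case False
      then have mV: "m \<in> V" using m(1) verts_eq by auto
      have MV: "M \<in> V"
        using d_adj[OF _ mV, of M] M(1) M' m' verts_eq by auto
      have "d b = 6 * (k + 1)" if "b \<in> U" for b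
        using d_adj[OF that mV] d_adj[OF that MV] M' m' by auto
      then show ?thesis
        using that verts_eq nonempty(1) d_adj by fastforce
    qed
    then have "(\<Sum>v\<in>verts G. \<bar>d v - 6 * (k + 1)\<bar>) \<le> (\<Sum>v\<in>verts G. 2)"
      by (intro sum_mono) auto
    then have "(\<Sum>v\<in>verts G. \<bar>d v - 6 * (k + 1)\<bar>) \<le> 3 * int (card (verts G))"
      by simp
    then show ?thesis
      unfolding sum by blast
  qed
qed

lemma recolouring_dist_le:
  assumes "c \<in> colourings 3 G" "d \<in> colourings 3 G"
  shows "R.\<mu> (\<lambda>_. 1) c d \<le> ereal (real (3 * card (verts G) div 2))"
proof -
  obtain z w where z: "parity_height z" "colour_of z = c" and w: "parity_height w" "colour_of w = d"
    using colouring_lift assms by meson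
  obtain k where k: "(\<Sum>v\<in>verts G. \<bar>z v - (w v + 6 * k)\<bar>) \<le> 3 * int (card (verts G))"
    using near_lift[OF z(1) w(1)] by blast
  have "parity_height (\<lambda>v. w v + 6 * k)"
    using w(1) by (simp add: parity_height_def height_add_const)
  from parity_height_even_diff[OF z(1) this] this
  obtain p where p: "R.awalk c p d" "2 * int (length p) = (\<Sum>v\<in>verts G. \<bar>z v - (w v + 6 * k)\<bar>)"
    using height_walk_exists[of z "\<lambda>v. w v + 6 * k"] z w
    unfolding colour_of_shift parity_height_def by auto
  have "length p \<le> 3 * card (verts G) div 2"
    using p(2) k by linarith
  then show ?thesis
    using recolouring_dist_le_walk[OF p(1)] order_trans by fastforce
qed

section \<open>Lower bound and the diameter\<close>

text \<open>Relative to \<open>z\<close>, the lifts of the second colouring with matching parities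
  have height sums \<open>2 * (3 * n div 2) + 6 * k * n\<close>. The values for \<open>k = 0\<close>
  and \<open>k = -1\<close> are those closest to 0 on either side, and both are at least
  \<open>2 * (3 * n div 2)\<close> in absolute value. A walk drifts by at most 2 per step.\<close>

lemma recolouring_dist_ge:
  shows "\<exists>c\<in>colourings 3 G. \<exists>d\<in>colourings 3 G.
    ereal (real (3 * card (verts G) div 2)) \<le> R.\<mu> (\<lambda>_. 1) c d"
proof -
  define n where "n = card (verts G)"
  define z :: "'a \<Rightarrow> int" where "z v = (if v \<in> U then 0 else 1)" for v
  have z: "height z"
    using disjoint by (auto simp: height_iff z_def)
  have "(\<Sum>v\<in>verts G. z v + 6 - z v) = 6 * int n"
    by (simp add: n_def)
  \<comment> \<open>A full turn to \<open>z + 6\<close> raises the sum by \<open>6 * n\<close>;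
    \<open>y\<close> stops about halfway, at the largest even number up to
    \<open>3 * n\<close>.\<close>
  then obtain y where y: "height y" "\<And>v. v \<in> verts G \<Longrightarrow> even (z v - y v)"
    and y_sum: "(\<Sum>v\<in>verts G. y v - z v) = 2 * int (3 * n div 2)"
    using height_intermediate[OF z, of "\<lambda>v. z v + 6" "3 * n div 2"] z
    unfolding height_add_const by fastforce
  have "3 * n div 2 \<le> length p" if walk: "R.awalk (colour_of z) p (colour_of y)" for p
  proof -
    obtain w where w: "height w" "colour_of w = colour_of y"
      "\<And>v. v \<in> verts G \<Longrightarrow> even (z v - w v)" "\<bar>\<Sum>v\<in>verts G. w v - z v\<bar> \<le> 2 * int (length p)"
      using height_lift_walk[OF z walk] by blast
    have "even (y v - w v)" if "v \<in> verts G" for v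
      using y(2)[OF that] w(3)[OF that] by presburger
    then obtain k where k: "\<And>v. v \<in> verts G \<Longrightarrow> w v = y v + 6 * k"
      using lift_unique[OF y(1) w(1)] w(2) by metis
    have "(\<Sum>v\<in>verts G. w v - z v) = (\<Sum>v\<in>verts G. (y v - z v) + 6 * k)"
      using k by (intro sum.cong) auto
    also have "\<dots> = 2 * int (3 * n div 2) + 6 * k * int n"
      unfolding sum.distrib y_sum by (simp add: n_def)
    finally have eq: "(\<Sum>v\<in>verts G. w v - z v) = 2 * int (3 * n div 2) + 6 * (k * int n)"
      by simp
    \<comment> \<open>As \<open>k\<close> is an integer, no value falls strictly between
      \<open>- n\<close> and 0, and the final estimate is linear in the product.\<close>
    have "k * int n \<ge> 0 \<or> k * int n \<le> - int n"
    proof (cases "k \<ge> 0")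
      case False
      then have "k * int n \<le> (-1) * int n"
        by (intro mult_right_mono) auto
      then show ?thesis by simp
    qed simp
    then show ?thesis
      using w(4) unfolding eq by linarith
  qed
  then show ?thesis
    using recolouring_dist_geI[of "colour_of z" "colour_of y" "3 * n div 2"]
      colour_of_in_colourings z y(1)
    unfolding n_def by blast
qed

lemma diam_recolouring_graph: "R.diam = ereal (real (3 * card (verts G) div 2))"
proof -
  have verts: "pverts (recolouring_graph 3 G) = colourings 3 G"
    by (simp add: recolouring_graph_def)
  obtain c d where cd: "c \<in> colourings 3 G" "d \<in> colourings 3 G"
    "ereal (real (3 * card (verts G) div 2)) \<le> R.\<mu> (\<lambda>_. 1) c d"
    using recolouring_dist_ge by blast
  show ?thesis
    unfolding R.diam_def
  proof (rule antisym)
    show "(SUP (u, v) \<in> verts (with_proj (recolouring_graph 3 G)) \<times> verts (with_proj (recolouring_graph 3 G)).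
        R.\<mu> (\<lambda>_. 1) u v) \<le> ereal (real (3 * card (verts G) div 2))"
      by (rule SUP_least) (auto simp: verts intro: recolouring_dist_le)
    show "ereal (real (3 * card (verts G) div 2))
      \<le> (SUP (u, v) \<in> verts (with_proj (recolouring_graph 3 G)) \<times> verts (with_proj (recolouring_graph 3 G)).
        R.\<mu> (\<lambda>_. 1) u v)"
      using cd by (intro SUP_upper2[of "(c, d)"]) (auto simp: verts)
  qed
qed

end

theorem proposition2:
  fixes p q :: nat and G :: "('a, 'b) pre_digraph"
  assumes "p \<ge> 1" and "q \<ge> 1"
    and "K\<^bsub>p,q\<^esub> G"
  shows "wf_digraph.diam (with_proj (recolouring_graph 3 G)) =
           ereal (of_int \<lfloor>3 * (real p + real q) / 2\<rfloor>)"
proof -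
  obtain U V where "graph G" and UV: "verts G = U \<union> V" "U \<inter> V = {}" "card U = p" "card V = q"
      "arcs_ends G = U \<times> V \<union> V \<times> U"
    using assms(3) unfolding complete_bipartite_digraph_def by blast
  interpret graph G by fact
  interpret bipartition G U V
    using UV assms(1,2) by unfold_locales auto
  have "finite U" "finite V"
    using finite_verts UV(1) by auto
  then have "card (verts G) = p + q"
    using UV by (simp add: card_Un_disjoint)
  moreover have "\<lfloor>3 * (real p + real q) / 2\<rfloor> = int (3 * (p + q) div 2)"
    using floor_divide_of_nat_eq[of "3 * (p + q)" 2] by simp
  ultimately show ?thesis
    using diam_recolouring_graph by simp
qed

end
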